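(* Let $n\ge 1$ be an integer. Every invertible $n\times n$ complex matrix is a product of $2n$ companion matrices of size $n\times n$. Every $n\times n$ complex matrix is a product (in some order) of $4n$ companion matrices and a diagonal matrix, all of size $n\times n$.
   Context: An $n\times n$ companion matrix is a matrix of the form \[ \begin{bmatrix} 0 & 0 &\cdots & 0 &c_1\\ 1 & 0 &\cdots & 0 &c_2\\ \vdots & \vdots & \ddots&\vdots & \vdots\\ 0 & 0 &\cdots & 1 & c_n \end{bmatrix} \] with arbitrary $c_1,\dots,c_n\in\mathbb{C}$ (ones on the first subdiagonal, last column $(c_1,\dots,c_n)^{\mathsf T}$, zeros elsewhere). Diagonal matrices have arbitrary complex diagonal entries. *)

theory Defs
  imports Complex_Main "Jordan_Normal_Form.Matrix"
begin

(* Indices start at 0, so the entry c i is the mathematical c_(i+1).  For n = 1 the only entry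
   lies in the last column, and the matrix is the arbitrary 1 x 1 matrix with entry c 0. *)
definition companion_mat :: "nat \<Rightarrow> (nat \<Rightarrow> complex) \<Rightarrow> complex mat" where
  "companion_mat n c =
     mat n n (\<lambda>(i, j). if j = n - 1 then c i else if i = j + 1 then 1 else 0)"

definition is_companion_mat :: "nat \<Rightarrow> complex mat \<Rightarrow> bool" where
  "is_companion_mat n A \<longleftrightarrow> (\<exists>c. A = companion_mat n c)"

(* The size n is a parameter because it fixes the identity matrix, the value on the empty list. *)
definition prod_mats :: "nat \<Rightarrow> complex mat list \<Rightarrow> complex mat" where
  "prod_mats n As = foldr (*) As (1\<^sub>m n)"

end

theory Submission
  imports Defs "Jordan_Normal_Form.Determinant"
begin

text \<open>
  Multiplying a matrix on the right by a companion matrix drops its first column, moves the others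
  one place to the left and appends an arbitrary linear combination of the old columns. Hence, if
  \<open>v\<^sub>0, v\<^sub>1, \<dots>\<close> is a sequence of vectors in dimension \<open>n\<close> and the matrix of \<open>n\<close> consecutive
  terms (a window) is invertible, then the next window is obtained from it by one companion factor
  (\<open>window_Suc_companion\<close>). Writing an invertible \<open>A\<close> with columns \<open>a\<^sub>j\<close> as a product of
  \<open>2 * n\<close> companion matrices therefore amounts to finding a sequence of \<open>3 * n\<close> vectors that
  starts with the unit vectors \<open>e\<^sub>j\<close>, ends with the \<open>a\<^sub>j\<close>, and has only invertible windows
  before the last one (\<open>window_companion_product\<close>).

  For the middle block take \<open>(1 - s) e\<^sub>j + s a\<^sub>j\<close> with one scalar \<open>s\<close>. The determinant of each window
  is a polynomial in \<open>s\<close>. For the windows that lie in the first two blocks, \<open>s = 0\<close> gives a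
  cyclic rearrangement of the \<open>e\<^sub>j\<close>; for those that lie in the last two, \<open>s = 1\<close> gives a cyclic
  rearrangement of the \<open>a\<^sub>j\<close>. So none of these finitely many polynomials vanishes identically,
  and some \<open>s\<close> avoids the roots of all of them (\<open>path_windows_invertible\<close>).

  For an arbitrary matrix, Gaussian elimination on rows and columns gives \<open>A = P * D * Q\<close> with \<open>D\<close>
  diagonal and \<open>P\<close>, \<open>Q\<close> invertible (\<open>mat_equivalent_diagonal\<close>); each of \<open>P\<close> and \<open>Q\<close> is a
  product of \<open>2 * n\<close> companion matrices.
\<close>

section \<open>Windows of a vector sequence\<close>

definition window :: "nat \<Rightarrow> (nat \<Rightarrow> nat \<Rightarrow> 'a) \<Rightarrow> nat \<Rightarrow> 'a mat" where
  "window n v k = mat n n (\<lambda>(i, j). v (k + j) i)"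

lemma window_carrier [simp]: "window n v k \<in> carrier_mat n n"
  by (simp add: window_def)

lemma companion_carrier [simp]: "companion_mat n c \<in> carrier_mat n n"
  by (simp add: companion_mat_def)

lemma obtain_inverse:
  fixes A :: "'a::field mat"
  assumes A: "A \<in> carrier_mat n n" and "det A \<noteq> 0"
  obtains B where "B \<in> carrier_mat n n" "A * B = 1\<^sub>m n" "B * A = 1\<^sub>m n"
  using det_non_zero_imp_unit[OF assms, where b = "()"]
  by (auto simp: Units_def ring_mat_def)

lemma mult_mat_unit_vec:
  fixes A :: "'a::semiring_1 mat"
  assumes "A \<in> carrier_mat m n" "j < n"
  shows "A *\<^sub>v unit_vec n j = col A j"
  using assms by (intro eq_vecI) auto

lemma window_Suc:
  assumes n: "n \<ge> 1" and next_vec: "vec n (v (k + n)) = window n v k *\<^sub>v vec n c"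
  shows "window n v (Suc k) = window n v k * companion_mat n c"
proof (rule mat_col_eqI)
  fix j assume "j < dim_col (window n v k * companion_mat n c)"
  then have j: "j < n" by (simp add: companion_mat_def)
  have "window n v k *\<^sub>v col (companion_mat n c) j = vec n (v (Suc k + j))"
  proof (cases "j = n - 1")
    case True
    then have "col (companion_mat n c) j = vec n c"
      using n by (auto simp: companion_mat_def)
    then show ?thesis
      using True n next_vec by simp
  next
    case False
    then have "col (companion_mat n c) j = unit_vec n (Suc j)"
      using j by (auto simp: companion_mat_def unit_vec_def)
    moreover have "window n v k *\<^sub>v unit_vec n (Suc j) = col (window n v k) (Suc j)"
      using False j by (intro mult_mat_unit_vec[of _ n n]) auto
    ultimately show ?thesis
      using False j by (auto simp: window_def)
  qed
  then show "col (window n v (Suc k)) j = col (window n v k * companion_mat n c) j"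
    using j by (subst col_mult2[of _ n n _ n]) (auto simp: window_def)
qed (auto simp: window_def companion_mat_def)

text \<open>
  The columns of an invertible window form a basis, so the last column of the companion matrix can
  be chosen as the coordinates of the incoming vector in that basis.
\<close>
lemma window_Suc_companion:
  assumes n: "n \<ge> 1" and det: "det (window n v k) \<noteq> 0"
  shows "\<exists>C. is_companion_mat n C \<and> window n v (Suc k) = window n v k * C"
proof -
  obtain B where B: "B \<in> carrier_mat n n" "window n v k * B = 1\<^sub>m n"
    using obtain_inverse[OF window_carrier det] by metis
  define u where "u = B *\<^sub>v vec n (v (k + n))"
  have u: "u \<in> carrier_vec n"
    using B by (auto simp: u_def)
  then have "vec n (($) u) = u" by auto
  moreover have "window n v k *\<^sub>v u = vec n (v (k + n))"
    unfolding u_def using B by (subst assoc_mult_mat_vec[symmetric, of _ n n _ n]) auto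
  ultimately show ?thesis
    using window_Suc[OF n, of v k "($) u"] by (auto simp: is_companion_mat_def)
qed

lemma prod_mats_carrier:
  assumes "set As \<subseteq> carrier_mat n n"
  shows "prod_mats n As \<in> carrier_mat n n"
  using assms by (induction As) (auto simp: prod_mats_def)

lemma prod_mats_append:
  assumes "set As \<subseteq> carrier_mat n n" "set Bs \<subseteq> carrier_mat n n"
  shows "prod_mats n (As @ Bs) = prod_mats n As * prod_mats n Bs"
  using assms(1)
proof (induction As)
  case Nil
  then show ?case
    using prod_mats_carrier[OF assms(2)] by (simp add: prod_mats_def)
next
  case (Cons A As)
  then have "A * prod_mats n As * prod_mats n Bs = A * (prod_mats n As * prod_mats n Bs)"
    using prod_mats_carrier[of As n] prod_mats_carrier[OF assms(2)]
    by (intro assoc_mult_mat[of _ n n _ n _ n]) auto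
  with Cons show ?case by (simp add: prod_mats_def)
qed

lemma prod_mats_single: "A \<in> carrier_mat n n \<Longrightarrow> prod_mats n [A] = A"
  by (simp add: prod_mats_def)

lemma companion_set_carrier:
  "\<forall>C \<in> set Cs. is_companion_mat n C \<Longrightarrow> set Cs \<subseteq> carrier_mat n n"
  by (auto simp: is_companion_mat_def)

lemma window_companion_product:
  assumes n: "n \<ge> 1" and det: "\<And>k. k < m \<Longrightarrow> det (window n v k) \<noteq> 0"
  shows "\<exists>Cs. length Cs = m \<and> (\<forall>C \<in> set Cs. is_companion_mat n C) \<and>
          window n v m = window n v 0 * prod_mats n Cs"
  using det
proof (induction m)
  case 0
  have "window n v 0 * 1\<^sub>m n = window n v 0"
    by (rule right_mult_one_mat[of _ n]) simp
  then show ?case by (simp add: prod_mats_def)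
next
  case (Suc m)
  then obtain Cs where Cs: "length Cs = m" "\<forall>C \<in> set Cs. is_companion_mat n C"
      "window n v m = window n v 0 * prod_mats n Cs"
    by auto
  obtain C where C: "is_companion_mat n C" "window n v (Suc m) = window n v m * C"
    using window_Suc_companion[OF n Suc.prems[of m]] by auto
  have "set Cs \<subseteq> carrier_mat n n" "C \<in> carrier_mat n n"
    using Cs(2) C(1) companion_set_carrier by (auto simp: is_companion_mat_def)
  then have "window n v (Suc m) = window n v 0 * prod_mats n (Cs @ [C])"
    using C(2) Cs(3) prod_mats_carrier[of Cs n]
    by (simp add: prod_mats_append prod_mats_single assoc_mult_mat[of _ n n _ n _ n])
  then show ?case
    using Cs C(1) by (intro exI[of _ "Cs @ [C]"]) auto
qed

section \<open>A path with generically invertible windows\<close>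

text \<open>
  In a sequence of period \<open>n\<close> the incoming vector equals the outgoing one, so every step is
  multiplication by the same companion matrix, the one with last column \<open>e\<^sub>0\<close>.
\<close>
lemma window_rotate:
  fixes v :: "nat \<Rightarrow> nat \<Rightarrow> complex"
  assumes n: "n \<ge> 1" and per: "\<And>k. v (k + n) = v k"
  shows "det (window n v k) = det (window n v 0) * det (companion_mat n (\<lambda>i. of_bool (i = 0))) ^ k"
proof (induction k)
  case (Suc k)
  have "vec n (\<lambda>i. of_bool (i = 0)) = (unit_vec n 0 :: complex vec)"
    by (auto simp: unit_vec_def)
  then have "window n v k *\<^sub>v vec n (\<lambda>i. of_bool (i = 0)) = col (window n v k) 0"
    using n by (simp add: mult_mat_unit_vec[of _ n n])
  also have "\<dots> = vec n (v (k + n))"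
    using n by (auto simp: window_def per)
  finally have "window n v (Suc k) = window n v k * companion_mat n (\<lambda>i. of_bool (i = 0))"
    using n by (intro window_Suc) auto
  then show ?case
    using Suc by (simp add: det_mult[of _ n])
qed simp

text \<open>
  Rotating the columns of the identity \<open>n\<close> times restores it, so the \<open>n\<close>-th power of this determinant
  is 1.
\<close>
lemma det_rotation_nonzero:
  assumes n: "n \<ge> 1"
  shows "det (companion_mat n (\<lambda>i. of_bool (i = 0))) \<noteq> 0"
proof -
  define v where "v = (\<lambda>k i. of_bool (i = k mod n) :: complex)"
  have "window n v k = 1\<^sub>m n" if "k = 0 \<or> k = n" for k
    using that by (auto simp: window_def v_def)
  then have "det (window n v 0) = 1" "det (window n v n) = 1"
    by auto
  moreover have "v (k + n) = v k" for k
    by (simp add: v_def)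
  ultimately show ?thesis
    using window_rotate[of n v n] n by (auto simp: power_0_left)
qed

definition cyclic_cols :: "nat \<Rightarrow> 'a mat \<Rightarrow> nat \<Rightarrow> nat \<Rightarrow> 'a" where
  "cyclic_cols n A k i = A $$ (i, k mod n)"

lemma det_window_cyclic_cols:
  assumes n: "n \<ge> 1" and A: "A \<in> carrier_mat n n" and det: "det A \<noteq> 0"
  shows "det (window n (cyclic_cols n A) k) \<noteq> (0 :: complex)"
proof -
  have "window n (cyclic_cols n A) 0 = A"
    using A by (auto simp: window_def cyclic_cols_def)
  moreover have "cyclic_cols n A (k + n) = cyclic_cols n A k" for k
    by (auto simp: cyclic_cols_def)
  ultimately show ?thesis
    using window_rotate[OF n, of "cyclic_cols n A" k] det_rotation_nonzero[OF n] det
    by simp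
qed

lemma poly_det:
  fixes M :: "'a::comm_ring_1 poly mat"
  assumes M: "M \<in> carrier_mat n n"
  shows "poly (det M) s = det (map_mat (\<lambda>p. poly p s) M)"
proof -
  have "comm_ring_hom (\<lambda>p. poly p s)"
    by unfold_locales auto
  from comm_ring_hom.hom_det[OF this] show ?thesis by simp
qed

lemma finite_nonzero_polys_common_nonroot:
  fixes p :: "'i \<Rightarrow> 'a::{idom, ring_char_0} poly"
  assumes "finite I" "\<And>i. i \<in> I \<Longrightarrow> p i \<noteq> 0"
  obtains s where "\<And>i. i \<in> I \<Longrightarrow> poly (p i) s \<noteq> 0"
proof -
  have "prod p I \<noteq> 0" using assms by simp
  then obtain s where "poly (prod p I) s \<noteq> 0"
    using poly_all_0_iff_0 by blast
  then show ?thesis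
    using that assms(1) by (auto simp: poly_prod)
qed

text \<open>
  The sequence of \<open>3 * n\<close> columns joining the identity to \<open>A\<close>: the three blocks interpolate between
  them with weights 0, \<open>s\<close> and 1. It is stated over any commutative ring so that \<open>s\<close> can also be the
  polynomial variable.
\<close>
definition path_cols :: "nat \<Rightarrow> 'a::comm_ring_1 mat \<Rightarrow> 'a \<Rightarrow> nat \<Rightarrow> nat \<Rightarrow> 'a" where
  "path_cols n A s k i =
     (let t = (if k < n then 0 else if k < 2 * n then s else 1)
      in (1 - t) * cyclic_cols n (1\<^sub>m n) k i + t * cyclic_cols n A k i)"

lemma window_path_first:
  assumes "A \<in> carrier_mat n n"
  shows "window n (path_cols n A s) 0 = 1\<^sub>m n"
  using assms by (auto simp: window_def path_cols_def cyclic_cols_def)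

lemma window_path_last:
  assumes "A \<in> carrier_mat n n"
  shows "window n (path_cols n A s) (2 * n) = A"
  using assms by (auto simp: window_def path_cols_def cyclic_cols_def)

lemma window_path_0:
  assumes "k \<le> n"
  shows "window n (path_cols n A 0) k = window n (cyclic_cols n (1\<^sub>m n)) k"
  using assms by (auto simp: window_def path_cols_def)

lemma window_path_1:
  assumes "n \<le> k"
  shows "window n (path_cols n A 1) k = window n (cyclic_cols n A) k"
  using assms by (auto simp: window_def path_cols_def)

lemma path_windows_invertible:
  fixes A :: "complex mat"
  assumes n: "n \<ge> 1" and A: "A \<in> carrier_mat n n" and det: "det A \<noteq> 0"
  obtains s where "\<And>k. k < 2 * n \<Longrightarrow> det (window n (path_cols n A s) k) \<noteq> 0"
proof -
  \<comment> \<open>\<open>[:0, 1:]\<close> is the polynomial variable, which takes the place of \<open>s\<close>.\<close>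
  define M where "M = (\<lambda>k. window n (path_cols n (map_mat (\<lambda>a. [:a:]) A) [:0, 1:]) k)"
  have eval: "poly (det (M k)) s = det (window n (path_cols n A s) k)" for k s
  proof -
    have "map_mat (\<lambda>p. poly p s) (M k) = window n (path_cols n A s) k"
      using n A by (auto simp: M_def window_def path_cols_def cyclic_cols_def Let_def)
    then show ?thesis
      using poly_det[of "M k" n s] by (simp add: M_def)
  qed
  \<comment> \<open>Up to \<open>k = n\<close> a window sees only the first two blocks, afterwards only the last two.\<close>
  have "det (M k) \<noteq> 0" for k
  proof (cases "k \<le> n")
    case True
    then have "poly (det (M k)) 0 \<noteq> 0"
      using det_window_cyclic_cols[OF n, of "1\<^sub>m n" k] by (simp add: eval window_path_0)
    then show ?thesis by auto
  next
    case False
    then have "poly (det (M k)) 1 \<noteq> 0"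
      using det_window_cyclic_cols[OF n A det, of k] by (simp add: eval window_path_1)
    then show ?thesis by auto
  qed
  then show ?thesis
    using finite_nonzero_polys_common_nonroot[of "{..<2 * n}" "\<lambda>k. det (M k)"] that
    by (auto simp: eval)
qed

text \<open>
  The path for a good \<open>s\<close> has its first window equal to the identity and its window number \<open>2 * n\<close>
  equal to \<open>A\<close>.
\<close>
lemma det_nonzero_companion_product:
  assumes n: "n \<ge> 1" and A: "A \<in> carrier_mat n n" and det: "det A \<noteq> 0"
  shows "\<exists>Cs. length Cs = 2 * n \<and> (\<forall>C \<in> set Cs. is_companion_mat n C) \<and> A = prod_mats n Cs"
proof -
  obtain s where s: "\<And>k. k < 2 * n \<Longrightarrow> det (window n (path_cols n A s) k) \<noteq> 0"
    using path_windows_invertible[OF assms] by blast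
  then obtain Cs where Cs: "length Cs = 2 * n" "\<forall>C \<in> set Cs. is_companion_mat n C"
      "A = 1\<^sub>m n * prod_mats n Cs"
    using window_companion_product[OF n, of "2 * n" "path_cols n A s"]
    by (auto simp: window_path_first[OF A] window_path_last[OF A])
  then have "A = prod_mats n Cs"
    using prod_mats_carrier[OF companion_set_carrier[OF Cs(2)]] by simp
  then show ?thesis using Cs by blast
qed

lemma invertible_mat_det_nonzero:
  fixes A :: "'a::field mat"
  assumes A: "A \<in> carrier_mat n n" and inv: "invertible_mat A"
  shows "det A \<noteq> 0"
proof -
  obtain B where B: "A * B = 1\<^sub>m n" "B * A = 1\<^sub>m (dim_row B)"
    using A inv unfolding invertible_mat_def inverts_mat_def by auto
  have "dim_col B = n"
    using arg_cong[OF B(1), of dim_col] by simp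
  moreover have "dim_row B = n"
    using arg_cong[OF B(2), of dim_col] A by simp
  ultimately have carrier: "B \<in> carrier_mat n n"
    by (rule carrier_matI[rotated])
  have "det A * det B = det (1\<^sub>m n)"
    unfolding det_mult[OF A carrier, symmetric] B(1) ..
  then have "det A * det B = 1"
    by simp
  then show ?thesis by auto
qed

section \<open>Diagonalization under two-sided multiplication\<close>

definition mat_equivalent :: "nat \<Rightarrow> 'a::field mat \<Rightarrow> 'a mat \<Rightarrow> bool" where
  "mat_equivalent n A B \<longleftrightarrow> B \<in> carrier_mat n n \<and>
     (\<exists>P \<in> carrier_mat n n. \<exists>Q \<in> carrier_mat n n. det P \<noteq> 0 \<and> det Q \<noteq> 0 \<and> A = P * B * Q)"

lemma mat_equivalent_refl: "A \<in> carrier_mat n n \<Longrightarrow> mat_equivalent n A A"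
  unfolding mat_equivalent_def
  by (intro conjI bexI[of _ "1\<^sub>m n"]) auto

lemma mat_equivalent_trans:
  assumes "mat_equivalent n A B" "mat_equivalent n B C"
  shows "mat_equivalent n A C"
proof -
  obtain P Q where PQ: "P \<in> carrier_mat n n" "Q \<in> carrier_mat n n" "det P \<noteq> 0" "det Q \<noteq> 0"
      "A = P * B * Q"
    using assms(1) by (auto simp: mat_equivalent_def)
  obtain R S where RS: "R \<in> carrier_mat n n" "S \<in> carrier_mat n n" "det R \<noteq> 0" "det S \<noteq> 0"
      "B = R * C * S"
    using assms(2) by (auto simp: mat_equivalent_def)
  have C: "C \<in> carrier_mat n n"
    using assms(2) by (simp add: mat_equivalent_def)
  have "A = (P * R) * C * (S * Q)"
    using PQ RS C by (simp add: assoc_mult_mat[of _ n n _ n _ n])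
  moreover have "det (P * R) \<noteq> 0" "det (S * Q) \<noteq> 0"
    using PQ RS by (auto simp: det_mult[of _ n])
  ultimately show ?thesis
    using PQ(1,2) RS(1,2) C mult_carrier_mat unfolding mat_equivalent_def by blast
qed

lemma mat_equivalent_left_mult:
  assumes A: "A \<in> carrier_mat n n" and L: "L \<in> carrier_mat n n" and det: "det L \<noteq> 0"
  shows "mat_equivalent n A (L * A)"
proof -
  obtain M where M: "M \<in> carrier_mat n n" "M * L = 1\<^sub>m n"
    using obtain_inverse[OF L det] by metis
  have "det M * det L = 1"
    using det_mult[OF M(1) L] M(2) by simp
  then have "det M \<noteq> 0" by auto
  moreover have "A = M * (L * A) * 1\<^sub>m n"
    using A L M by (simp add: assoc_mult_mat[of M n n L n A n, symmetric])
  ultimately show ?thesis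
    unfolding mat_equivalent_def using A L M
    by (intro conjI bexI[of _ M] bexI[of _ "1\<^sub>m n"]) auto
qed

text \<open>
  Turns the row operations below into column operations.
\<close>
lemma mat_equivalent_transpose:
  assumes "mat_equivalent n A B"
  shows "mat_equivalent n (transpose_mat A) (transpose_mat B)"
proof -
  obtain P Q where PQ: "P \<in> carrier_mat n n" "Q \<in> carrier_mat n n" "det P \<noteq> 0" "det Q \<noteq> 0"
      "A = P * B * Q" and B: "B \<in> carrier_mat n n"
    using assms by (auto simp: mat_equivalent_def)
  have "transpose_mat A = transpose_mat Q * transpose_mat B * transpose_mat P"
    using PQ B by (simp add: transpose_mult[of _ n n _ n] assoc_mult_mat[of _ n n _ n _ n])
  then show ?thesis
    unfolding mat_equivalent_def using PQ B
    by (intro conjI bexI[of _ "transpose_mat Q"] bexI[of _ "transpose_mat P"])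
      (auto simp: det_transpose[of _ n])
qed

lemma mat_equivalent_swaprows:
  assumes A: "A \<in> carrier_mat n n" and k: "k < n" and l: "l < n"
  shows "mat_equivalent n A (swaprows k l A)"
proof (cases "k = l")
  case True
  then have "swaprows k l A = A" using A k by (auto simp: mat_swaprows_def)
  then show ?thesis using A mat_equivalent_refl by metis
next
  case False
  then show ?thesis
    using mat_equivalent_left_mult[OF A, of "swaprows_mat n k l"] A k l
    by (simp add: swaprows_mat[OF A k l] det_swaprows_mat)
qed

text \<open>
  The result of subtracting multiples of row \<open>k\<close> from the rows below it so that, when the pivot
  \<open>A $$ (k, k)\<close> is nonzero, column \<open>k\<close> becomes zero below the diagonal.
\<close>
definition clear_below :: "nat \<Rightarrow> nat \<Rightarrow> 'a::field mat \<Rightarrow> 'a mat" where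
  "clear_below n k A = mat n n (\<lambda>(i, j).
     A $$ (i, j) - (if k < i then A $$ (i, k) / A $$ (k, k) * A $$ (k, j) else 0))"

lemma mat_equivalent_clear_below:
  assumes A: "A \<in> carrier_mat n n" and k: "k < n"
  shows "mat_equivalent n A (clear_below n k A)"
proof -
  \<comment> \<open>All row operations of this elimination step at once, a unit lower triangular matrix.\<close>
  define L where "L = mat n n (\<lambda>(i, j). of_bool (i = j) -
    (if j = k \<and> k < i then A $$ (i, k) / A $$ (k, k) else 0))"
  have L: "L \<in> carrier_mat n n" by (simp add: L_def)
  have "diag_mat L = replicate n 1"
    by (rule nth_equalityI) (auto simp: diag_mat_def L_def)
  then have "det L = 1"
    by (subst det_lower_triangular[OF _ L]) (auto simp: L_def)
  moreover have "L * A = clear_below n k A"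
  proof (rule eq_matI)
    fix i j assume "i < dim_row (clear_below n k A)" "j < dim_col (clear_below n k A)"
    then have ij: "i < n" "j < n" by (auto simp: clear_below_def)
    have "(L * A) $$ (i, j) = (\<Sum>l<n. L $$ (i, l) * A $$ (l, j))"
      using ij A L by (simp add: scalar_prod_def lessThan_atLeast0)
    also have "\<dots> = (\<Sum>l<n. (if l = i then A $$ (i, j) else 0) -
        (if l = k then (if k < i then A $$ (i, k) / A $$ (k, k) * A $$ (k, j) else 0) else 0))"
      using ij by (intro sum.cong) (auto simp: L_def)
    also have "\<dots> = clear_below n k A $$ (i, j)"
      using ij k by (simp add: sum_subtractf clear_below_def)
    finally show "(L * A) $$ (i, j) = clear_below n k A $$ (i, j)" .
  qed (use A L in \<open>auto simp: clear_below_def\<close>)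
  ultimately show ?thesis
    using mat_equivalent_left_mult[OF A L] by simp
qed

text \<open>
  The invariant of the elimination: rows and columns with index below \<open>k\<close> are finished.
\<close>
definition diagonal_upto :: "nat \<Rightarrow> nat \<Rightarrow> 'a::zero mat \<Rightarrow> bool" where
  "diagonal_upto n k A \<longleftrightarrow> (\<forall>i<n. \<forall>j<n. i \<noteq> j \<and> (i < k \<or> j < k) \<longrightarrow> A $$ (i, j) = 0)"

lemma diagonal_upto_pivot:
  assumes A: "A \<in> carrier_mat n n" and diag: "diagonal_upto n k A"
    and ij: "i < n" "j < n" "k \<le> i" "k \<le> j" "A $$ (i, j) \<noteq> 0"
  obtains B where "mat_equivalent n A B" "diagonal_upto n k B" "B $$ (k, k) \<noteq> 0"
proof -
  have k: "k < n" using ij by simp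
  define A1 where "A1 = swaprows k i A"
  have A1: "A1 \<in> carrier_mat n n" using A by (simp add: A1_def)
  define B where "B = transpose_mat (swaprows k j (transpose_mat A1))"
  have "mat_equivalent n A A1"
    using mat_equivalent_swaprows[OF A k ij(1)] by (simp add: A1_def)
  moreover have "mat_equivalent n A1 B"
    using mat_equivalent_transpose[OF mat_equivalent_swaprows[of "transpose_mat A1" n k j]]
      A1 k ij(2) by (simp add: B_def)
  ultimately have "mat_equivalent n A B"
    by (rule mat_equivalent_trans)
  moreover have "diagonal_upto n k B"
    using diag A ij by (auto simp: diagonal_upto_def B_def A1_def)
  moreover have "B $$ (k, k) \<noteq> 0"
    using A ij k by (auto simp: B_def A1_def)
  ultimately show ?thesis using that by blast
qed

text \<open>
  Clearing column \<open>k\<close> below the pivot leaves row \<open>k\<close> alone. Once that column is clear, clearing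
  the row through the transpose does not disturb it. The finished rows and columns have zeros in all
  positions that enter these operations.
\<close>
lemma diagonal_upto_clear:
  assumes A: "A \<in> carrier_mat n n" and k: "k < n"
    and diag: "diagonal_upto n k A" and pivot: "A $$ (k, k) \<noteq> 0"
  obtains B where "mat_equivalent n A B" "diagonal_upto n (Suc k) B"
proof -
  define A1 where "A1 = clear_below n k A"
  have A1: "A1 \<in> carrier_mat n n" by (simp add: A1_def clear_below_def)
  define B where "B = transpose_mat (clear_below n k (transpose_mat A1))"
  have "mat_equivalent n A A1"
    using mat_equivalent_clear_below[OF A k] by (simp add: A1_def)
  moreover have "mat_equivalent n A1 B"
    using mat_equivalent_transpose[OF mat_equivalent_clear_below[of "transpose_mat A1" n k]]
      A1 k by (simp add: B_def)
  ultimately have "mat_equivalent n A B"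
    by (rule mat_equivalent_trans)
  moreover have "diagonal_upto n (Suc k) B"
    using diag pivot k
    by (auto simp: diagonal_upto_def B_def A1_def clear_below_def less_Suc_eq)
  ultimately show ?thesis using that by blast
qed

text \<open>
  If the unfinished lower right block is nonzero, a nonzero entry of it is moved to position
  \<open>(k, k)\<close> and used as pivot; if it is zero, the matrix is already diagonal.
\<close>
lemma mat_equivalent_diagonal_upto:
  assumes A: "A \<in> carrier_mat n n" and "k \<le> n"
  shows "\<exists>B. mat_equivalent n A B \<and> diagonal_upto n k B"
  using assms(2)
proof (induction k)
  case 0
  show ?case
    using mat_equivalent_refl[OF A] by (auto simp: diagonal_upto_def)
next
  case (Suc k)
  then obtain B where B: "mat_equivalent n A B" "diagonal_upto n k B" by auto
  then have carrier: "B \<in> carrier_mat n n" by (simp add: mat_equivalent_def)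
  show ?case
  proof (cases "\<exists>i j. i < n \<and> j < n \<and> k \<le> i \<and> k \<le> j \<and> B $$ (i, j) \<noteq> 0")
    case True
    then obtain B1 where B1: "mat_equivalent n B B1" "diagonal_upto n k B1" "B1 $$ (k, k) \<noteq> 0"
      using diagonal_upto_pivot[OF carrier B(2)] by metis
    then obtain B2 where "mat_equivalent n B1 B2" "diagonal_upto n (Suc k) B2"
      using diagonal_upto_clear[of B1 n k] Suc.prems by (auto simp: mat_equivalent_def)
    then show ?thesis
      using B(1) B1(1) mat_equivalent_trans by blast
  next
    case False
    then have "diagonal_upto n (Suc k) B"
      using B(2) by (auto simp: diagonal_upto_def) (metis not_less)+
    then show ?thesis using B(1) by blast
  qed
qed

lemma mat_equivalent_diagonal:
  assumes "A \<in> carrier_mat n n"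
  obtains D where "mat_equivalent n A D" "diagonal_mat D"
proof -
  obtain D where D: "mat_equivalent n A D" "diagonal_upto n n D"
    using mat_equivalent_diagonal_upto[OF assms order_refl] by blast
  then have "diagonal_mat D"
    by (auto simp: mat_equivalent_def diagonal_upto_def diagonal_mat_def)
  then show ?thesis using D(1) that by blast
qed

section \<open>Products of companion matrices\<close>

theorem theorem6p2:
  fixes n :: nat
  assumes "n \<ge> 1"
  shows "(\<forall>A \<in> carrier_mat n n. invertible_mat A \<longrightarrow>
            (\<exists>Cs. length Cs = 2 * n \<and> (\<forall>C \<in> set Cs. is_companion_mat n C) \<and>
                  A = prod_mats n Cs)) \<and>
         (\<forall>A \<in> carrier_mat n n.
            (\<exists>Cs D Cs'. length Cs + length Cs' = 4 * n \<and>
                  (\<forall>C \<in> set Cs \<union> set Cs'. is_companion_mat n C) \<and>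
                  D \<in> carrier_mat n n \<and> diagonal_mat D \<and>
                  A = prod_mats n (Cs @ [D] @ Cs')))"
proof (intro conjI ballI impI)
  fix A :: "complex mat"
  assume "A \<in> carrier_mat n n" "invertible_mat A"
  then show "\<exists>Cs. length Cs = 2 * n \<and> (\<forall>C \<in> set Cs. is_companion_mat n C) \<and>
      A = prod_mats n Cs"
    using det_nonzero_companion_product[OF assms] invertible_mat_det_nonzero by blast
next
  fix A :: "complex mat"
  assume "A \<in> carrier_mat n n"
  then obtain D where equiv: "mat_equivalent n A D" and diag: "diagonal_mat D"
    by (rule mat_equivalent_diagonal)
  from equiv obtain P Q where D: "D \<in> carrier_mat n n"
    and PQ: "P \<in> carrier_mat n n" "Q \<in> carrier_mat n n" "det P \<noteq> 0" "det Q \<noteq> 0" "A = P * D * Q"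
    unfolding mat_equivalent_def by blast
  obtain Cs where Cs: "length Cs = 2 * n" "\<forall>C \<in> set Cs. is_companion_mat n C" "P = prod_mats n Cs"
    using det_nonzero_companion_product[OF assms PQ(1,3)] by blast
  obtain Cs' where Cs': "length Cs' = 2 * n" "\<forall>C \<in> set Cs'. is_companion_mat n C"
      "Q = prod_mats n Cs'"
    using det_nonzero_companion_product[OF assms PQ(2,4)] by blast
  have sets: "set Cs \<subseteq> carrier_mat n n" "set Cs' \<subseteq> carrier_mat n n"
    using Cs(2) Cs'(2) companion_set_carrier by auto
  have "prod_mats n (Cs @ [D] @ Cs') = prod_mats n Cs * prod_mats n (D # Cs')"
    using prod_mats_append[of Cs n "D # Cs'"] sets D by simp
  also have "\<dots> = P * (D * Q)"
    unfolding Cs(3) Cs'(3) by (simp add: prod_mats_def)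
  also have "\<dots> = A"
    unfolding PQ(5) by (rule assoc_mult_mat[OF PQ(1) D PQ(2), symmetric])
  finally have "A = prod_mats n (Cs @ [D] @ Cs')" ..
  then show "\<exists>Cs D Cs'. length Cs + length Cs' = 4 * n \<and>
      (\<forall>C \<in> set Cs \<union> set Cs'. is_companion_mat n C) \<and>
      D \<in> carrier_mat n n \<and> diagonal_mat D \<and> A = prod_mats n (Cs @ [D] @ Cs')"
    using Cs(1,2) Cs'(1,2) D diag by (intro exI[of _ Cs] exI[of _ D] exI[of _ Cs']) auto
qed

end
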